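(* Let $p,q\ge 1$ be integers, $n=p+q$, and let $\rho\in\mathbf{C}$. If $u\in H_\rho$, i.e. $u$ is a spherical harmonic of degree $\rho$ on $S^{p,q}$, then $\Delta_{S^{p,q}}u=-\rho(\rho+n-2)\,u$ on $S^{p,q}$.
   Context: $\mathbf{R}^{p,q}$ is $\mathbf{R}^n$, $n=p+q$, with the indefinite scalar product $\mathbf{x}\cdot\mathbf{y}=\sum_{i=1}^p x_iy_i-\sum_{i=p+1}^n x_iy_i$; write $|\mathbf{x}|^2=\mathbf{x}\cdot\mathbf{x}$. Let $\mathbf{R}^{p,q}_+=\{\mathbf{x}\in\mathbf{R}^{p,q}:|\mathbf{x}|^2>0\}$, and for $\mathbf{x}\in\mathbf{R}^{p,q}_+$ let $|\mathbf{x}|$ be the positive square root of $|\mathbf{x}|^2$. $S^{p,q}$ is the connected component of $(1,0,\ldots,0)$ in $\{\mathbf{x}\in\mathbf{R}^{p,q}_+:|\mathbf{x}|=1,\ x_1>0\}$. $\Delta=\sum_{i=1}^p\frac{\partial^2}{\partial x_i^2}-\sum_{i=p+1}^n\frac{\partial^2}{\partial x_i^2}$. For $\rho\in\mathbf{C}$, $\mathcal{P}_\rho$ is the space of complex-valued $f\in C^2(\mathbf{R}^{p,q}_+)$ with $f(\lambda\mathbf{x})=\lambda^\rho f(\mathbf{x})$ for all $\mathbf{x}\in\mathbf{R}^{p,q}_+$ and $\lambda>0$ (where $\lambda^\rho=e^{\rho\log\lambda}$ with real logarithm), $\mathcal{H}_\rho=\{f\in\mathcal{P}_\rho:\Delta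 f=0\}$, and $H_\rho=\{f|_{S^{p,q}}:f\in\mathcal{H}_\rho\}$; elements of $H_\rho$ are called spherical harmonics of degree $\rho$. For $u\in C^2(S^{p,q})$, the degree zero homogeneous extension of $u$ is $\tilde u(\mathbf{x})=u(\mathbf{x}/|\mathbf{x}|)$, defined on the open cone $\{\lambda\mathbf{y}:\lambda>0,\ \mathbf{y}\in S^{p,q}\}$. The Laplace-Beltrami operator on $S^{p,q}$ is defined by $\Delta_{S^{p,q}}u=(\Delta\tilde u)|_{S^{p,q}}$. *)

theory Defs
  imports "HOL-Analysis.Analysis"
begin

text \<open>
  The space \<open>R^{p,q}\<close> is \<open>real ^ ('p + 'q)\<close> with \<open>p = CARD('p)\<close> and \<open>q = CARD('q)\<close>; both are
  at least 1 because types are nonempty. Coordinates \<open>Inl i\<close> are the \<open>p\<close> positive ones and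
  coordinates \<open>Inr j\<close> the \<open>q\<close> negative ones. As \<open>'p\<close> carries no order, the index
  \<open>k :: 'p\<close> of the coordinate called \<open>x_1\<close> is an explicit parameter where it matters.
\<close>

definition pq_inner :: "real ^ ('p::finite + 'q::finite) \<Rightarrow> real ^ ('p + 'q) \<Rightarrow> real" where
  "pq_inner x y = (\<Sum>i\<in>UNIV. x $ Inl i * y $ Inl i) - (\<Sum>j\<in>UNIV. x $ Inr j * y $ Inr j)"

definition pq_pos :: "(real ^ ('p::finite + 'q::finite)) set" where
  "pq_pos = {x. pq_inner x x > 0}"

text \<open>Only meaningful on \<open>pq_pos\<close>.\<close>

definition pq_norm :: "real ^ ('p::finite + 'q::finite) \<Rightarrow> real" where
  "pq_norm x = sqrt (pq_inner x x)"

definition pq_sphere :: "'p \<Rightarrow> (real ^ ('p::finite + 'q::finite)) set" where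
  "pq_sphere k =
     connected_component_set {x \<in> pq_pos. pq_norm x = 1 \<and> x $ Inl k > 0} (axis (Inl k) 1)"

definition partial_deriv ::
  "'n::finite \<Rightarrow> (real ^ 'n \<Rightarrow> complex) \<Rightarrow> real ^ 'n \<Rightarrow> complex" where
  "partial_deriv i f x = vector_derivative (\<lambda>t. f (x + t *\<^sub>R axis i 1)) (at 0)"

definition pq_laplacian ::
  "(real ^ ('p::finite + 'q::finite) \<Rightarrow> complex) \<Rightarrow> real ^ ('p + 'q) \<Rightarrow> complex" where
  "pq_laplacian f x =
     (\<Sum>i\<in>UNIV. partial_deriv (Inl i) (partial_deriv (Inl i) f) x)
     - (\<Sum>j\<in>UNIV. partial_deriv (Inr j) (partial_deriv (Inr j) f) x)"

text \<open>Twice continuously (Frechet) differentiable; intended for open \<open>S\<close>.\<close>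

definition C2_on :: "(real ^ 'n::finite \<Rightarrow> complex) \<Rightarrow> (real ^ 'n) set \<Rightarrow> bool" where
  "C2_on f S \<longleftrightarrow>
     (\<exists>(f' :: real ^ 'n \<Rightarrow> (real ^ 'n) \<Rightarrow>\<^sub>L complex)
       (f'' :: real ^ 'n \<Rightarrow> (real ^ 'n) \<Rightarrow>\<^sub>L ((real ^ 'n) \<Rightarrow>\<^sub>L complex)).
        (\<forall>x\<in>S. (f has_derivative blinfun_apply (f' x)) (at x)) \<and>
        (\<forall>x\<in>S. (f' has_derivative blinfun_apply (f'' x)) (at x)) \<and>
        continuous_on S f'')"

text \<open>
  Functions on \<open>pq_pos\<close> are represented by total functions whose values outside the open set
  \<open>pq_pos\<close> are irrelevant. For \<open>l > 0\<close> the principal branch in \<open>powr\<close> gives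
  \<open>exp (\<rho> * ln l)\<close> with the real logarithm.
\<close>

definition homogeneous_C2 ::
  "complex \<Rightarrow> (real ^ ('p::finite + 'q::finite) \<Rightarrow> complex) set" where
  "homogeneous_C2 \<rho> =
     {f. C2_on f pq_pos \<and>
         (\<forall>x\<in>pq_pos. \<forall>l>0. f (l *\<^sub>R x) = complex_of_real l powr \<rho> * f x)}"

definition homogeneous_harmonic ::
  "complex \<Rightarrow> (real ^ ('p::finite + 'q::finite) \<Rightarrow> complex) set" where
  "homogeneous_harmonic \<rho> =
     {f \<in> homogeneous_C2 \<rho>. \<forall>x\<in>pq_pos. pq_laplacian f x = 0}"

definition spherical_harmonics ::
  "'p \<Rightarrow> complex \<Rightarrow> (real ^ ('p::finite + 'q::finite) \<Rightarrow> complex) set" where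
  "spherical_harmonics k \<rho> = (\<lambda>f. restrict f (pq_sphere k)) ` homogeneous_harmonic \<rho>"

definition pq_sphere_cone :: "'p \<Rightarrow> (real ^ ('p::finite + 'q::finite)) set" where
  "pq_sphere_cone k = {l *\<^sub>R y | l y. l > 0 \<and> y \<in> pq_sphere k}"

definition degree_zero_extension ::
  "'p \<Rightarrow> (real ^ ('p::finite + 'q::finite) \<Rightarrow> complex) \<Rightarrow> real ^ ('p + 'q) \<Rightarrow> complex" where
  "degree_zero_extension k u = restrict (\<lambda>x. u (x /\<^sub>R pq_norm x)) (pq_sphere_cone k)"

definition laplace_beltrami ::
  "'p \<Rightarrow> (real ^ ('p::finite + 'q::finite) \<Rightarrow> complex) \<Rightarrow> real ^ ('p + 'q) \<Rightarrow> complex" where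
  "laplace_beltrami k u = restrict (pq_laplacian (degree_zero_extension k u)) (pq_sphere k)"

end

theory Submission
  imports Defs
begin

text \<open>
  Let \<open>Q x = pq_inner x x\<close>. If \<open>u\<close> is the restriction of the homogeneous harmonic function \<open>f\<close>,
  then near a point of the sphere the degree zero extension of \<open>u\<close> is \<open>Q powr a * f\<close> with
  \<open>a = - \<rho> / 2\<close>. By the product rule, the equations \<open>\<partial>\<^sub>i Q = 2 \<sigma>\<^sub>i x\<^sub>i\<close> for the signs
  \<open>\<sigma>\<^sub>i = \<plusminus>1\<close> of the form, and Euler's identity \<open>\<Sum>\<^sub>i x\<^sub>i \<partial>\<^sub>i f = \<rho> f\<close>, its Laplacian where
  \<open>Q = 1\<close> is \<open>(4 a (a - 1) + 2 a n + 4 a \<rho>) f = - \<rho> (\<rho> + n - 2) f\<close>.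
\<close>

text \<open>\<open>partial_deriv\<close> is total and has a value even where no derivative exists;
  this relation also records existence, which the product and chain rules require.\<close>

abbreviation has_partial ::
  "(real ^ 'n::finite \<Rightarrow> complex) \<Rightarrow> 'n \<Rightarrow> complex \<Rightarrow> real ^ 'n \<Rightarrow> bool" where
  "has_partial f i D x \<equiv>
     ((\<lambda>t. f (x + t *\<^sub>R axis i 1)) has_vector_derivative D) (at (0::real))"

lemma partial_deriv_eqI: "has_partial f i D x \<Longrightarrow> partial_deriv i f x = D"
  unfolding partial_deriv_def by (rule vector_derivative_at)

lemma has_partial_cong_open:
  assumes "open S" "x \<in> S" "\<And>y. y \<in> S \<Longrightarrow> f y = g y" "has_partial f i D x"
  shows "has_partial g i D x"
proof -
  define T where "T = (\<lambda>t::real. x + t *\<^sub>R axis i 1) -` S"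
  have "open T"
    unfolding T_def by (intro open_vimage assms continuous_intros)
  moreover have "0 \<in> T" using assms by (simp add: T_def)
  ultimately show ?thesis
    by (rule has_vector_derivative_transform_within_open[OF assms(4)])
       (use assms(3) in \<open>auto simp: T_def\<close>)
qed

text \<open>The outer derivative sees \<open>partial_deriv i f\<close> along a whole segment around
  \<open>x\<close>, so the first partial is computed on an open set.\<close>

lemma second_partial_deriv_eqI:
  assumes "open S" "x \<in> S" "\<And>y. y \<in> S \<Longrightarrow> has_partial f i (g y) y" "has_partial g i D x"
  shows "partial_deriv i (partial_deriv i f) x = D"
proof (rule partial_deriv_eqI, rule has_partial_cong_open)
  show "\<And>y. y \<in> S \<Longrightarrow> g y = partial_deriv i f y"
    using assms(3) partial_deriv_eqI by metis
qed (use assms in auto)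

text \<open>\<open>vector_derivative\<close> is a choice among the derivatives of a function. Local
  agreement makes the two sets of candidates equal, so the choices agree whether or not a derivative
  exists.\<close>

lemma partial_deriv_cong_open:
  assumes "open S" "x \<in> S" "\<And>y. y \<in> S \<Longrightarrow> f y = g y"
  shows "partial_deriv i f x = partial_deriv i g x"
proof -
  have "has_partial f i D x \<longleftrightarrow> has_partial g i D x" for D
    using has_partial_cong_open[of S x f g i D] has_partial_cong_open[of S x g f i D] assms by metis
  then show ?thesis
    by (simp add: partial_deriv_def vector_derivative_def)
qed

lemma pq_laplacian_cong_open:
  assumes "open S" "x \<in> S" "\<And>y. y \<in> S \<Longrightarrow> f y = g y"
  shows "pq_laplacian f x = pq_laplacian g x"
proof -
  have "partial_deriv i (partial_deriv i f) x = partial_deriv i (partial_deriv i g) x" for i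
    by (intro partial_deriv_cong_open[OF assms(1)] assms)
  then show ?thesis by (simp add: pq_laplacian_def)
qed

lemma has_partial_of_has_derivative:
  assumes "(f has_derivative f') (at x)"
  shows "has_partial f i (f' (axis i 1)) x"
proof -
  have "((\<lambda>t. x + t *\<^sub>R axis i 1) has_vector_derivative axis i 1) (at (0::real))"
    by (auto intro!: derivative_eq_intros)
  from vector_derivative_diff_chain_within[OF this, of f f'] assms
  show ?thesis by (simp add: o_def has_derivative_at_withinI)
qed

text \<open>The diagonal entries of the form. They turn the two blocks \<open>Inl\<close> and
  \<open>Inr\<close> into a single sum over all coordinates.\<close>

definition pq_sign :: "'p::finite + 'q::finite \<Rightarrow> real" where
  "pq_sign i = (case i of Inl _ \<Rightarrow> 1 | Inr _ \<Rightarrow> - 1)"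

lemma of_real_pq_sign_sq:
  "of_real (pq_sign i) * of_real (pq_sign i) = (1 :: complex)"
  "of_real (pq_sign i) * (of_real (pq_sign i) * z) = (z :: complex)"
  by (simp_all add: pq_sign_def split: sum.split)

lemma sum_UNIV_Plus:
  "(\<Sum>i\<in>(UNIV :: ('p::finite + 'q::finite) set). g i)
     = (\<Sum>i\<in>UNIV. g (Inl i)) + (\<Sum>j\<in>UNIV. g (Inr j) :: 'a::comm_monoid_add)"
  by (simp flip: UNIV_Plus_UNIV add: sum.Plus)

lemma pq_inner_conv_sign: "pq_inner x y = (\<Sum>i\<in>UNIV. pq_sign i * (x $ i * y $ i))"
  by (simp add: sum_UNIV_Plus pq_inner_def pq_sign_def sum_negf)

lemma pq_laplacian_conv_sign:
  "pq_laplacian f x = (\<Sum>i\<in>UNIV. of_real (pq_sign i) * partial_deriv i (partial_deriv i f) x)"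
  by (simp add: sum_UNIV_Plus pq_laplacian_def pq_sign_def sum_negf)

text \<open>The linear coefficient in \<open>t\<close> yields the partial derivative of
  \<open>Q\<close>.\<close>

lemma pq_inner_line:
  "pq_inner (x + t *\<^sub>R axis i 1) (x + t *\<^sub>R axis i 1)
     = pq_inner x x + pq_sign i * (2 * t * x $ i + t\<^sup>2)"
proof -
  have "pq_sign j * ((x + t *\<^sub>R axis i 1) $ j * (x + t *\<^sub>R axis i 1) $ j)
      = pq_sign j * (x $ j * x $ j)
        + (if j = i then pq_sign i * (2 * t * x $ i + t\<^sup>2) else 0)" for j
    by (auto simp: axis_def power2_eq_square algebra_simps)
  then show ?thesis
    by (simp add: pq_inner_conv_sign sum.distrib)
qed

lemma pq_inner_scaleR: "pq_inner (a *\<^sub>R x) (b *\<^sub>R y) = a * b * pq_inner x y"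
  by (simp add: pq_inner_def sum_distrib_left right_diff_distrib algebra_simps)

lemma continuous_on_pq_inner_self [continuous_intros]:
  "continuous_on S (\<lambda>x. pq_inner x x)"
  unfolding pq_inner_def by (intro continuous_intros)

lemma open_pq_pos: "open pq_pos"
  unfolding pq_pos_def by (intro open_Collect_less continuous_intros)

text \<open>Chain rule along a coordinate line; \<open>Q x > 0\<close> keeps the base off the branch
  cut of the complex power.\<close>

lemma has_partial_powr_pq_inner:
  assumes "x \<in> pq_pos"
  shows "has_partial (\<lambda>y. of_real (pq_inner y y) powr a) i
           (2 * a * of_real (pq_sign i * x $ i) * of_real (pq_inner x x) powr (a - 1)) x"
proof -
  let ?q = "\<lambda>t. complex_of_real (pq_inner x x + pq_sign i * (2 * t * x $ i + t\<^sup>2))"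
  have "(?q has_vector_derivative of_real (2 * pq_sign i * x $ i)) (at 0)"
    by (rule has_vector_derivative_of_real) (auto intro!: derivative_eq_intros)
  moreover have "((\<lambda>z. z powr a) has_field_derivative a * ?q 0 powr (a - 1)) (at (?q 0))"
    using assms by (intro has_field_derivative_powr) (auto simp: pq_pos_def)
  ultimately have "((\<lambda>z. z powr a) \<circ> ?q has_vector_derivative
      of_real (2 * pq_sign i * x $ i) * (a * ?q 0 powr (a - 1))) (at 0)"
    by (rule field_vector_diff_chain_at)
  then show ?thesis
    by (simp add: o_def pq_inner_line mult_ac)
qed

lemma has_partial_coord: "has_partial (\<lambda>y. c * of_real (y $ i)) i c x"
  by (auto intro!: derivative_eq_intros simp: axis_def)

lemma has_partial_mult:
  assumes "has_partial f i f' x" "has_partial g i g' x"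
  shows "has_partial (\<lambda>y. f y * g y) i (f x * g' + f' * g x) x"
  using has_vector_derivative_mult[OF assms] by simp

lemma has_partial_add:
  assumes "has_partial f i f' x" "has_partial g i g' x"
  shows "has_partial (\<lambda>y. f y + g y) i (f' + g') x"
  using has_vector_derivative_add[OF assms] by simp

lemma has_partial_partial_powr_pq_inner:
  assumes "x \<in> pq_pos"
  shows "has_partial
           (\<lambda>y. 2 * a * of_real (pq_sign i * y $ i) * of_real (pq_inner y y) powr (a - 1)) i
           (4 * a * (a - 1) * of_real ((x $ i)\<^sup>2) * of_real (pq_inner x x) powr (a - 2)
            + 2 * a * of_real (pq_sign i) * of_real (pq_inner x x) powr (a - 1)) x"
  using has_partial_mult[OF has_partial_coord[where c = "2 * a * of_real (pq_sign i)"]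
      has_partial_powr_pq_inner[OF assms, where a = "a - 1" and i = i]]
  by (simp add: algebra_simps power2_eq_square of_real_pq_sign_sq)

text \<open>Both sides are the derivative of \<open>f (t *\<^sub>R x)\<close> at
  \<open>t = 1\<close>: one by the chain rule and linearity of \<open>f'\<close>, the other by
  homogeneity, valid for \<open>t > 0\<close>.\<close>

lemma Euler_homogeneous:
  assumes "f \<in> homogeneous_C2 \<rho>" "x \<in> pq_pos" "(f has_derivative f') (at x)"
  shows "(\<Sum>i\<in>UNIV. of_real (x $ i) * f' (axis i 1)) = \<rho> * f x"
proof -
  interpret f': bounded_linear f' using assms(3) by (rule has_derivative_bounded_linear)
  have "((\<lambda>t. t *\<^sub>R x) has_vector_derivative x) (at (1::real))"
    by (auto intro!: derivative_eq_intros)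
  from vector_derivative_diff_chain_within[OF this, of f f'] assms(3)
  have 1: "((\<lambda>t. f (t *\<^sub>R x)) has_vector_derivative f' x) (at 1)"
    by (simp add: o_def has_derivative_at_withinI)
  have "(complex_of_real has_vector_derivative 1) (at 1)"
    by (auto intro!: derivative_eq_intros)
  moreover have "((\<lambda>z. z powr \<rho> * f x) has_field_derivative \<rho> * f x) (at (complex_of_real 1))"
    by (auto intro!: derivative_eq_intros)
  ultimately have "((\<lambda>t. of_real t powr \<rho> * f x) has_vector_derivative \<rho> * f x) (at (1::real))"
    using field_vector_diff_chain_at[of complex_of_real 1 1 "\<lambda>z. z powr \<rho> * f x"]
    by (simp add: o_def)
  then have "((\<lambda>t. f (t *\<^sub>R x)) has_vector_derivative \<rho> * f x) (at 1)"
    by (rule has_vector_derivative_transform_within_open[of _ _ _ "{0<..}"])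
       (use assms in \<open>auto simp: homogeneous_C2_def\<close>)
  with 1 have "f' x = \<rho> * f x" by (rule vector_derivative_unique_at)
  moreover have "f' x = f' (\<Sum>i\<in>UNIV. x $ i *\<^sub>R axis i 1)"
    using basis_expansion[of x] by (simp add: scalar_mult_eq_scaleR)
  ultimately show ?thesis by (simp add: f'.sum f'.scaleR flip: scaleR_conv_of_real)
qed

lemma pq_laplacian_powr_mult:
  fixes f :: "real ^ ('p::finite + 'q::finite) \<Rightarrow> complex"
  assumes f: "f \<in> homogeneous_C2 \<rho>" and x: "pq_inner x x = 1"
  shows "pq_laplacian (\<lambda>y. of_real (pq_inner y y) powr a * f y) x
           = pq_laplacian f x
             + (4 * a * (a - 1) + 2 * a * of_nat (CARD('p) + CARD('q)) + 4 * a * \<rho>) * f x"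
proof -
  let ?w = "\<lambda>y::real ^ ('p + 'q). complex_of_real (pq_inner y y) powr a"
  let ?w' = "\<lambda>i (y::real ^ ('p + 'q)).
    2 * a * of_real (pq_sign i * y $ i) * of_real (pq_inner y y) powr (a - 1)"
  have xp: "x \<in> pq_pos" using x by (simp add: pq_pos_def)
  obtain f' :: "real ^ ('p + 'q) \<Rightarrow> (real ^ ('p + 'q)) \<Rightarrow>\<^sub>L complex" and f''
    where f': "\<And>y. y \<in> pq_pos \<Longrightarrow> (f has_derivative blinfun_apply (f' y)) (at y)"
      and f'': "\<And>y. y \<in> pq_pos \<Longrightarrow> (f' has_derivative blinfun_apply (f'' y)) (at y)"
    using f unfolding homogeneous_C2_def C2_on_def by blast
  let ?e = "\<lambda>i::'p + 'q. axis i (1::real)"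
  have d1: "has_partial f i (f' y (?e i)) y" if "y \<in> pq_pos" for i y
    using has_partial_of_has_derivative[OF f'[OF that]] .
  \<comment> \<open>Evaluation at a fixed vector is bounded linear, hence commutes with
    differentiating \<open>f'\<close>.\<close>
  have d2: "has_partial (\<lambda>y. f' y (?e i)) i (f'' y (?e i) (?e i)) y" if "y \<in> pq_pos" for i y
    by (rule has_partial_of_has_derivative
        [OF bounded_linear.has_derivative[OF blinfun.bounded_linear_left f''[OF that]]])
  have fii: "partial_deriv i (partial_deriv i f) x = f'' x (?e i) (?e i)" for i
    using second_partial_deriv_eqI[OF open_pq_pos xp d1 d2[OF xp]] .
  have gii: "partial_deriv i (partial_deriv i (\<lambda>y. ?w y * f y)) x
      = f'' x (?e i) (?e i) + 4 * a * of_real (pq_sign i * x $ i) * f' x (?e i)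
        + (4 * a * (a - 1) * of_real ((x $ i)\<^sup>2) + 2 * a * of_real (pq_sign i)) * f x"
    (is "_ = ?D i") for i
  proof (rule second_partial_deriv_eqI[OF open_pq_pos xp])
    show "has_partial (\<lambda>y. ?w y * f y) i (?w y * f' y (?e i) + ?w' i y * f y) y"
      if "y \<in> pq_pos" for y
      by (rule has_partial_mult[OF has_partial_powr_pq_inner[OF that] d1[OF that]])
    \<comment> \<open>The two equal mixed terms combine into the one with factor
      \<open>4 * a\<close>; all powers of \<open>Q\<close> become 1 because
      \<open>Q x = 1\<close>.\<close>
    show "has_partial (\<lambda>y. ?w y * f' y (?e i) + ?w' i y * f y) i (?D i) x"
      using has_partial_add[OF
          has_partial_mult[OF has_partial_powr_pq_inner[OF xp, where a = a and i = i] d2[OF xp]]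
          has_partial_mult[OF has_partial_partial_powr_pq_inner[OF xp, where a = a] d1[OF xp]]]
      by (simp add: x algebra_simps)
  qed
  have "pq_laplacian (\<lambda>y. ?w y * f y) x = (\<Sum>i\<in>UNIV. of_real (pq_sign i) * ?D i)"
    by (simp only: pq_laplacian_conv_sign gii)
  \<comment> \<open>As the signs square to 1, the mixed terms lose theirs and form Euler's sum, the
    squares acquire one and form \<open>Q x\<close>, and \<open>2 * a * f x\<close> occurs once per
    coordinate.\<close>
  also have "\<dots> = (\<Sum>i\<in>UNIV. of_real (pq_sign i) * f'' x (?e i) (?e i)
      + 4 * a * (of_real (x $ i) * f' x (?e i))
      + 4 * a * (a - 1) * f x * of_real (pq_sign i * (x $ i * x $ i)) + 2 * a * f x)"
    by (intro sum.cong refl) (simp add: algebra_simps power2_eq_square of_real_pq_sign_sq)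
  also have "\<dots> = (\<Sum>i\<in>UNIV. of_real (pq_sign i) * f'' x (?e i) (?e i))
      + 4 * a * (\<Sum>i\<in>UNIV. of_real (x $ i) * f' x (?e i))
      + 4 * a * (a - 1) * f x * of_real (pq_inner x x)
      + of_nat (CARD('p) + CARD('q)) * (2 * a * f x)"
    by (simp add: sum.distrib pq_inner_conv_sign sum_distrib_left)
  also have "\<dots> = pq_laplacian f x + 4 * a * (\<rho> * f x) + 4 * a * (a - 1) * f x
      + of_nat (CARD('p) + CARD('q)) * (2 * a * f x)"
    by (simp add: pq_laplacian_conv_sign fii x Euler_homogeneous[OF f xp f'[OF xp]])
  finally show ?thesis by (simp add: algebra_simps)
qed

lemma pq_sphereD:
  assumes "x \<in> pq_sphere k"
  shows "pq_inner x x = 1" "x $ Inl k > 0"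
  using connected_component_subset assms by (fastforce simp: pq_sphere_def pq_norm_def)+

text \<open>
  The normalization of a small ball around \<open>x\<close> is connected and contains \<open>x\<close>, so it stays in the
  component \<open>pq_sphere k\<close>. In particular the cone over the sphere is open.
\<close>

lemma normalize_nhd_pq_sphere:
  fixes x :: "real ^ ('p::finite + 'q::finite)"
  assumes x: "x \<in> pq_sphere k"
  obtains U where "open U" "x \<in> U" "U \<subseteq> pq_pos"
    "\<And>y. y \<in> U \<Longrightarrow> y /\<^sub>R pq_norm y \<in> pq_sphere k"
proof -
  let ?M = "{x \<in> pq_pos. pq_norm x = 1 \<and> x $ Inl k > 0} :: (real ^ ('p + 'q)) set"
  have "open (pq_pos \<inter> {y :: real ^ ('p + 'q). y $ Inl k > 0})"
    by (intro open_Int open_pq_pos open_Collect_less continuous_intros)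
  moreover have "x \<in> pq_pos \<inter> {y. y $ Inl k > 0}"
    using pq_sphereD[OF x] by (simp add: pq_pos_def)
  ultimately obtain e where e: "e > 0" "ball x e \<subseteq> pq_pos \<inter> {y. y $ Inl k > 0}"
    by (meson openE)
  let ?N = "(\<lambda>y. y /\<^sub>R pq_norm y) ` ball x e"
  have pos: "pq_inner y y > 0" "y $ Inl k > 0" if "y \<in> ball x e" for y
    using e that by (auto simp: pq_pos_def)
  have "continuous_on (ball x e) (\<lambda>y. y /\<^sub>R pq_norm y)"
    unfolding pq_norm_def using pos by (intro continuous_intros) fastforce
  then have "connected ?N" by (intro connected_continuous_image) auto
  moreover have "?N \<subseteq> ?M"
  proof (rule image_subsetI)
    fix y assume "y \<in> ball x e"
    note pos[OF this]
    moreover from this have "pq_inner (y /\<^sub>R pq_norm y) (y /\<^sub>R pq_norm y) = 1"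
      by (simp add: pq_inner_scaleR pq_norm_def field_simps)
    ultimately show "y /\<^sub>R pq_norm y \<in> ?M"
      by (simp add: pq_pos_def pq_norm_def)
  qed
  moreover have "x \<in> ?N"
    using e(1) pq_sphereD[OF x] by (intro image_eqI[of _ _ x]) (auto simp: pq_norm_def)
  ultimately have "?N \<subseteq> connected_component_set ?M x"
    by (intro connected_component_maximal)
  \<comment> \<open>\<open>x\<close> lies in the component of \<open>axis (Inl k) 1\<close>, so both
    points have the same component.\<close>
  also have "connected_component_set ?M x = pq_sphere k"
    using x connected_component_eq unfolding pq_sphere_def by blast
  finally have "?N \<subseteq> pq_sphere k" .
  then show thesis
    using e by (intro that[of "ball x e"]) auto
qed

theorem lemma2:
  fixes k :: "'p::finite"
    and \<rho> :: complex
    and u :: "real ^ ('p + 'q::finite) \<Rightarrow> complex"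
  assumes "u \<in> spherical_harmonics k \<rho>"
  shows "\<forall>x\<in>pq_sphere k.
           laplace_beltrami k u x = - \<rho> * (\<rho> + of_nat (CARD('p) + CARD('q)) - 2) * u x"
proof
  fix x :: "real ^ ('p + 'q)" assume x: "x \<in> pq_sphere k"
  obtain f where f: "f \<in> homogeneous_C2 \<rho>" and harm: "\<And>x. x \<in> pq_pos \<Longrightarrow> pq_laplacian f x = 0"
    and u: "u = restrict f (pq_sphere k)"
    using assms by (auto simp: spherical_harmonics_def homogeneous_harmonic_def)
  obtain U where U: "open U" "x \<in> U" "U \<subseteq> pq_pos"
    "\<And>y. y \<in> U \<Longrightarrow> y /\<^sub>R pq_norm y \<in> pq_sphere k"
    using normalize_nhd_pq_sphere[OF x] by metis
  have ext: "degree_zero_extension k u y = of_real (pq_inner y y) powr (- \<rho> / 2) * f y"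
    if y: "y \<in> U" for y
  proof -
    have Q: "pq_inner y y > 0" using U(3) y by (auto simp: pq_pos_def)
    then have r: "pq_norm y > 0" by (simp add: pq_norm_def)
    \<comment> \<open>Membership in the cone must be shown, since the extension is
      \<open>undefined\<close> outside it.\<close>
    then have "y = pq_norm y *\<^sub>R (y /\<^sub>R pq_norm y)" by simp
    then have "y \<in> pq_sphere_cone k"
      unfolding pq_sphere_cone_def using U(4)[OF y] r by blast
    then have "degree_zero_extension k u y = f (inverse (pq_norm y) *\<^sub>R y)"
      using U(4)[OF y] by (simp add: degree_zero_extension_def u)
    also have "\<dots> = of_real (inverse (pq_norm y)) powr \<rho> * f y"
      using f U(3) y r by (auto simp: homogeneous_C2_def simp del: of_real_inverse)
    \<comment> \<open>The real logarithm of the inverse norm is \<open>- ln Q / 2\<close>.\<close>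
    also have "complex_of_real (inverse (pq_norm y)) powr \<rho>
        = of_real (pq_inner y y) powr (- \<rho> / 2)"
      using Q r by (simp add: powr_def pq_norm_def ln_inverse ln_sqrt Ln_of_real
          del: of_real_inverse)
    finally show ?thesis .
  qed
  have Q: "pq_inner x x = 1" using pq_sphereD[OF x] by simp
  have "laplace_beltrami k u x = pq_laplacian (degree_zero_extension k u) x"
    using x by (simp add: laplace_beltrami_def)
  also have "\<dots> = pq_laplacian (\<lambda>y. of_real (pq_inner y y) powr (- \<rho> / 2) * f y) x"
    by (rule pq_laplacian_cong_open[OF U(1,2) ext])
  \<comment> \<open>The term \<open>pq_laplacian f x\<close> vanishes by harmonicity. For
    \<open>a = - \<rho> / 2\<close> the coefficients are \<open>\<rho>\<^sup>2 + 2 * \<rho>\<close>,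
    \<open>- \<rho> * n\<close> and \<open>- 2 * \<rho>\<^sup>2\<close>, where \<open>n\<close> is
    the dimension.\<close>
  also have "\<dots> = - \<rho> * (\<rho> + of_nat (CARD('p) + CARD('q)) - 2) * f x"
    using harm[of x] Q unfolding pq_laplacian_powr_mult[OF f Q]
    by (simp add: pq_pos_def field_simps)
  finally show "laplace_beltrami k u x
      = - \<rho> * (\<rho> + of_nat (CARD('p) + CARD('q)) - 2) * u x"
    using x by (simp add: u)
qed

end
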